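(* For every integer $k$ there exist a connected graph $G$ and an edge $e\in E(G)$ that is not a cut edge such that $\gamma_{\rm wcon}(G-e)-\gamma_{\rm wcon}(G)=k$.
   Context: Graphs are finite, simple, undirected. An edge $e$ is a cut edge if $G-e$ is disconnected. A set $D$ is dominating if every vertex outside $D$ has a neighbour in $D$; weakly convex if for any $a,b\in D$ some shortest $(a-b)$-path in the graph lies in $D$. $\gamma_{\rm wcon}(G)$ is the minimum size of a weakly convex dominating set of $G$. *)

theory Defs
  imports "Graph_Theory.Graph_Theory"
begin

text \<open>
  A finite simple undirected graph is a \<^locale>\<open>pair_graph\<close>: a finite vertex set with a
  symmetric irreflexive arc relation. An undirected edge \<open>uv\<close> is the pair of opposite arcs
  \<open>(u,v)\<close>, \<open>(v,u)\<close>, and is referred to by either one of them.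
\<close>

definition delete_edge :: "'a pair_pre_digraph \<Rightarrow> 'a \<times> 'a \<Rightarrow> 'a pair_pre_digraph" where
  "delete_edge G e = \<lparr> pverts = pverts G, parcs = parcs G - {(fst e, snd e), (snd e, fst e)} \<rparr>"

text \<open>
  The qualified name is used because \<open>connected\<close> is also a topological notion.
\<close>

definition cut_edge :: "'a pair_pre_digraph \<Rightarrow> 'a \<times> 'a \<Rightarrow> bool" where
  "cut_edge G e \<longleftrightarrow> e \<in> parcs G \<and> \<not> Digraph_Component.connected (delete_edge G e)"

definition dominating :: "'a pair_pre_digraph \<Rightarrow> 'a set \<Rightarrow> bool" where
  "dominating G D \<longleftrightarrow> D \<subseteq> pverts G \<and> (\<forall>v \<in> pverts G - D. \<exists>u \<in> D. (v, u) \<in> parcs G)"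

definition shortest_path :: "'a pair_pre_digraph \<Rightarrow> 'a \<Rightarrow> ('a \<times> 'a) awalk \<Rightarrow> 'a \<Rightarrow> bool" where
  "shortest_path G a p b \<longleftrightarrow> pre_digraph.apath G a p b \<and>
     (\<forall>q. pre_digraph.apath G a q b \<longrightarrow> length p \<le> length q)"

definition weakly_convex :: "'a pair_pre_digraph \<Rightarrow> 'a set \<Rightarrow> bool" where
  "weakly_convex G D \<longleftrightarrow> D \<subseteq> pverts G \<and>
     (\<forall>a \<in> D. \<forall>b \<in> D. \<exists>p. shortest_path G a p b \<and> set (pawalk_verts a p) \<subseteq> D)"

text \<open>
  Meaningful for connected graphs only, where the vertex set itself is weakly convex and
  dominating (see below); a disconnected graph with vertices has no weakly convex dominating set.
\<close>

definition wcon_domination_number :: "'a pair_pre_digraph \<Rightarrow> nat" (\<open>\<gamma>\<^sub>w\<^sub>c\<^sub>o\<^sub>n\<close>) where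
  "\<gamma>\<^sub>w\<^sub>c\<^sub>o\<^sub>n G = (LEAST n. \<exists>D. weakly_convex G D \<and> dominating G D \<and> card D = n)"

lemma pair_graph_delete_edge:
  assumes "pair_graph G"
  shows "pair_graph (delete_edge G e)"
proof -
  interpret pair_graph G by fact
  have *: "(b, a) \<in> parcs G" if "(a, b) \<in> parcs G" for a b
    using that by (rule arcs_symmetric)
  show ?thesis
    by unfold_locales
      (auto simp: delete_edge_def symmetric_def sym_def arc_fst_in_verts arc_snd_in_verts
        in_arcsD1 in_arcsD2 no_loops' pair_finite_verts pair_finite_arcs intro: * dest: no_loops')
qed

lemma dominating_pverts: "dominating G (pverts G)"
  by (simp add: dominating_def)

lemma weakly_convex_pverts:
  assumes "pair_graph G" and "Digraph_Component.connected G"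
  shows "weakly_convex G (pverts G)"
  unfolding weakly_convex_def
proof (intro conjI ballI)
  interpret pair_graph G by fact
  fix a b assume ab: "a \<in> pverts G" "b \<in> pverts G"
  have "strongly_connected G"
    using symmetric_connected_imp_strongly_connected assms(2) sym_arcs by blast
  then have "\<exists>p. apath a p b"
    using ab by (auto simp: strongly_connected_def reachable_apath)
  then obtain p where p: "apath a p b" "\<And>q. apath a q b \<Longrightarrow> length p \<le> length q"
    using exists_least_iff[of "\<lambda>n. \<exists>p. apath a p b \<and> length p = n"] by (metis not_less)
  have "set (pawalk_verts a p) \<subseteq> pverts G"
    using p(1) awalk_verts_in_verts unfolding apath_def by blast
  with p show "\<exists>p. shortest_path G a p b \<and> set (pawalk_verts a p) \<subseteq> pverts G"
    unfolding shortest_path_def by blast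
qed simp

end

theory Submission
  imports Defs "HOL-Library.Countable"
begin

text \<open>
  A set onto which the graph retracts (mapping each edge to an edge or to a single vertex) is
  weakly convex, provided its vertices lie in one component. Conversely, supports of leaves belong
  to every weakly convex dominating set, and so does the only common neighbour of two non-adjacent
  members. The graphs below are chosen so that these two facts force a unique minimum set both
  before and after deleting \<open>UV\<close>.

  For \<open>k = m > 0\<close>, the edge \<open>UV\<close> gives the paths \<open>A i - U - V\<close>; without it the distance from
  \<open>A i\<close> to \<open>V\<close> is still 2, but only along \<open>A i - X i - V\<close>, so each \<open>X i\<close> becomes forced.
  For \<open>k = -(m + 1)\<close>, the edge \<open>UV\<close> makes \<open>U\<close> the only common neighbour of \<open>Z\<close> and \<open>V\<close>, and
  then each \<open>X i\<close> is the only common neighbour of \<open>A i\<close> and \<open>U\<close>; without \<open>UV\<close> the graph retracts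
  onto the tree formed by the supports. For \<open>k = 0\<close> a triangle suffices.
\<close>

section \<open>Weak convexity in terms of relation powers\<close>

lemma awalk_imp_relpow:
  assumes "pair_wf_digraph G" "pre_digraph.awalk (with_proj G) a p b" "set (pawalk_verts a p) \<subseteq> D"
  shows "(a, b) \<in> (parcs G \<inter> D \<times> D) ^^ length p"
proof -
  interpret pair_wf_digraph G by fact
  show ?thesis using assms(2,3)
  proof (induction p arbitrary: a)
    case Nil
    then show ?case by (simp add: awalk_Nil_iff)
  next
    case (Cons e p)
    then have "e \<in> parcs G" "a = fst e" "awalk (snd e) p b"
      by (auto simp: awalk_Cons_iff)
    moreover have "snd e \<in> D"
      using Cons.prems(2) by (cases p) (use \<open>awalk (snd e) p b\<close> in \<open>auto simp: awalk_simps\<close>)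
    ultimately have "(a, snd e) \<in> parcs G \<inter> D \<times> D" "(snd e, b) \<in> (parcs G \<inter> D \<times> D) ^^ length p"
      using Cons by (auto simp: mem_Times_iff)
    then show ?case unfolding list.size(4) add_Suc_right add_0_right by (rule relpow_Suc_I2)
  qed
qed

text \<open>Membership \<open>a \<in> D\<close> matters for length 0: the zeroth power relates every
  element to itself, even one outside the graph.\<close>

lemma relpow_imp_awalk:
  assumes "pair_wf_digraph G" "D \<subseteq> pverts G" "a \<in> D" "(a, b) \<in> (parcs G \<inter> D \<times> D) ^^ n"
  shows "\<exists>p. pre_digraph.awalk (with_proj G) a p b \<and> length p = n \<and> set (pawalk_verts a p) \<subseteq> D"
proof -
  interpret pair_wf_digraph G by fact
  show ?thesis using assms(3,4)
  proof (induction n arbitrary: a)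
    case 0
    then show ?case using assms(2) by (intro exI[of _ "[]"]) (auto simp: awalk_Nil_iff)
  next
    case (Suc n)
    from Suc.prems(2) obtain c where c: "(a, c) \<in> parcs G" "c \<in> D"
      "(c, b) \<in> (parcs G \<inter> D \<times> D) ^^ n"
      by (blast dest: relpow_Suc_D2)
    with Suc.IH obtain p where "awalk c p b" "length p = n" "set (pawalk_verts c p) \<subseteq> D"
      by blast
    then show ?case using c Suc.prems(1)
      by (intro exI[of _ "(a, c) # p"]) (auto simp: awalk_Cons_iff)
  qed
qed

text \<open>Taking \<open>D = pverts G\<close> turns the two conversions above into statements about
  unrestricted walks.\<close>

lemma parcs_restrict_pverts:
  assumes "pair_wf_digraph G"
  shows "parcs G \<inter> pverts G \<times> pverts G = parcs G"
proof -
  interpret pair_wf_digraph G by fact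
  show ?thesis by (auto intro: in_arcsD1 in_arcsD2)
qed

text \<open>A repeated vertex encloses a closed piece of positive length; cutting it out leaves a
  shorter walk, against \<open>min\<close>.\<close>

lemma minimal_awalk_imp_apath:
  assumes "pair_wf_digraph G" "pre_digraph.awalk (with_proj G) a p b"
    and min: "\<And>k. (a, b) \<in> parcs G ^^ k \<Longrightarrow> length p \<le> k"
  shows "pre_digraph.apath (with_proj G) a p b"
proof -
  interpret pair_wf_digraph G by fact
  have "distinct (pawalk_verts a p)"
  proof (rule ccontr)
    assume "\<not> ?thesis"
    from awalk_not_distinct_decomp[OF assms(2) this]
    obtain q r s v where *: "p = q @ r @ s" "0 < length r" "awalk a q v" "awalk v s b"
      by auto
    then have "awalk a (q @ s) b" by (blast intro: awalk_appendI)
    then have "(a, b) \<in> parcs G ^^ length (q @ s)"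
      using awalk_imp_relpow[OF assms(1), of a "q @ s" b "pverts G"]
      unfolding parcs_restrict_pverts[OF assms(1)] by blast
    from min[OF this] * show False by simp
  qed
  with assms(2) show ?thesis by (simp add: apath_def)
qed

text \<open>Minimality among paths and among all walks agree because a shortest walk is a path. From
  here on weak convexity is handled without mentioning paths.\<close>

lemma weakly_convex_iff_relpow:
  assumes "pair_wf_digraph G"
  shows "weakly_convex G D \<longleftrightarrow> D \<subseteq> pverts G \<and>
    (\<forall>a\<in>D. \<forall>b\<in>D. \<exists>n. (a, b) \<in> (parcs G \<inter> D \<times> D) ^^ n \<and> (\<forall>k. (a, b) \<in> parcs G ^^ k \<longrightarrow> n \<le> k))"
proof -
  interpret pair_wf_digraph G by fact
  have "(\<exists>p. shortest_path G a p b \<and> set (pawalk_verts a p) \<subseteq> D) \<longleftrightarrow>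
    (\<exists>n. (a, b) \<in> (parcs G \<inter> D \<times> D) ^^ n \<and> (\<forall>k. (a, b) \<in> parcs G ^^ k \<longrightarrow> n \<le> k))"
    (is "?L \<longleftrightarrow> ?R") if D: "D \<subseteq> pverts G" and ab: "a \<in> D" "b \<in> D" for a b
  proof
    assume ?L
    then obtain p where p: "apath a p b" "\<And>q. apath a q b \<Longrightarrow> length p \<le> length q"
      "set (pawalk_verts a p) \<subseteq> D"
      unfolding shortest_path_def by blast
    have "length p \<le> k" if k: "(a, b) \<in> parcs G ^^ k" for k
    proof -
      \<comment> \<open>Only paths can be compared with \<open>p\<close> directly, so the walk of
        length \<open>k\<close> is replaced by a shortest walk, which is a path.\<close>
      define l where "l = (LEAST l. (a, b) \<in> parcs G ^^ l)"
      have l: "(a, b) \<in> parcs G ^^ l" "l \<le> k" "\<And>j. (a, b) \<in> parcs G ^^ j \<Longrightarrow> l \<le> j"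
        unfolding l_def using LeastI[of "\<lambda>l. (a, b) \<in> parcs G ^^ l", OF k]
          Least_le[of "\<lambda>l. (a, b) \<in> parcs G ^^ l"] k by auto
      have "a \<in> pverts G" using ab D by blast
      then obtain q where q: "awalk a q b" "length q = l"
        using relpow_imp_awalk[OF assms subset_refl, of a b l] l(1)
        unfolding parcs_restrict_pverts[OF assms] by blast
      then have "apath a q b" using minimal_awalk_imp_apath[OF assms q(1)] l(3) by blast
      with p(2) q(2) l(2) show ?thesis by fastforce
    qed
    moreover have "(a, b) \<in> (parcs G \<inter> D \<times> D) ^^ length p"
      using awalk_imp_relpow[OF assms _ p(3)] p(1) awalkI_apath by blast
    ultimately show ?R by blast
  next
    assume ?R
    then obtain n where n: "(a, b) \<in> (parcs G \<inter> D \<times> D) ^^ n"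
      "\<And>k. (a, b) \<in> parcs G ^^ k \<Longrightarrow> n \<le> k" by blast
    obtain p where p: "awalk a p b" "length p = n" "set (pawalk_verts a p) \<subseteq> D"
      using relpow_imp_awalk[OF assms D ab(1) n(1)] by blast
    have "n \<le> length q" if "apath a q b" for q
      using awalk_imp_relpow[OF assms awalkI_apath[OF that], of "pverts G"] that n(2)
      unfolding parcs_restrict_pverts[OF assms] by (auto dest: awalkI_apath)
    with minimal_awalk_imp_apath[OF assms p(1)] p n(2) show ?L
      unfolding shortest_path_def by blast
  qed
  then show ?thesis unfolding weakly_convex_def by (auto cong: conj_cong)
qed

section \<open>Retractions and distances\<close>

lemma relpow_subset:
  fixes R S :: "'a rel"
  shows "R \<subseteq> S \<Longrightarrow> R ^^ n \<subseteq> S ^^ n"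
  by (induction n) (simp_all add: relcomp_mono)

text \<open>Induction along the walk: a step collapsed by \<open>r\<close> is dropped, any other
  becomes one step of \<open>S\<close>.\<close>

lemma relpow_retract:
  assumes "\<And>x y. (x, y) \<in> R \<Longrightarrow> r x = r y \<or> (r x, r y) \<in> S" "(a, b) \<in> R ^^ n"
  shows "\<exists>m\<le>n. (r a, r b) \<in> S ^^ m"
  using assms(2)
proof (induction n arbitrary: b)
  case (Suc n)
  then obtain c where c: "(a, c) \<in> R ^^ n" "(c, b) \<in> R" by auto
  with Suc.IH obtain m where m: "m \<le> n" "(r a, r c) \<in> S ^^ m" by blast
  from assms(1)[OF c(2)] show ?case
  proof
    assume "(r c, r b) \<in> S"
    with m show ?thesis by (intro exI[of _ "Suc m"]) auto
  qed (use m in \<open>auto intro: le_SucI\<close>)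
qed simp

text \<open>A retraction maps walks to walks that are not longer, once repeated vertices are removed.\<close>

lemma weakly_convex_retract:
  assumes "pair_wf_digraph G" "D \<subseteq> pverts G"
    and "\<And>x y. (x, y) \<in> parcs G \<Longrightarrow> r x = r y \<or> (r x, r y) \<in> parcs G"
    and "\<And>x. x \<in> pverts G \<Longrightarrow> r x \<in> D" "\<And>x. x \<in> D \<Longrightarrow> r x = x"
    and conn: "\<And>a b. a \<in> D \<Longrightarrow> b \<in> D \<Longrightarrow> (a, b) \<in> (parcs G)\<^sup>*"
  shows "weakly_convex G D"
proof -
  interpret pair_wf_digraph G by fact
  let ?S = "parcs G \<inter> D \<times> D"
  have "\<exists>n. (a, b) \<in> ?S ^^ n \<and> (\<forall>k. (a, b) \<in> parcs G ^^ k \<longrightarrow> n \<le> k)"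
    if ab: "a \<in> D" "b \<in> D" for a b
  proof -
    have S: "r x = r y \<or> (r x, r y) \<in> ?S" if "(x, y) \<in> parcs G" for x y
      using assms(3)[OF that] assms(4) in_arcsD1[OF that] in_arcsD2[OF that] by blast
    define n where "n = (LEAST n. (a, b) \<in> parcs G ^^ n)"
    have n: "(a, b) \<in> parcs G ^^ n" "\<And>k. (a, b) \<in> parcs G ^^ k \<Longrightarrow> n \<le> k"
      unfolding n_def using conn[OF ab] by (auto simp: rtrancl_power intro: LeastI Least_le)
    from relpow_retract[of "parcs G" r ?S, OF S n(1)] assms(5) ab
    obtain m where m: "m \<le> n" "(a, b) \<in> ?S ^^ m" by auto
    \<comment> \<open>The image walk is also a walk of \<open>G\<close>, so minimality of
      \<open>n\<close> gives \<open>m = n\<close>, and the walk inside \<open>D\<close> is a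
      shortest one.\<close>
    moreover have "(a, b) \<in> parcs G ^^ m"
      using m(2) by (rule relpow_subset[THEN subsetD, rotated]) blast
    ultimately show ?thesis using n by (metis le_antisym)
  qed
  with assms(2) show ?thesis by (simp add: weakly_convex_iff_relpow[OF assms(1)])
qed

section \<open>Vertices forced into weakly convex dominating sets\<close>

definition wcd :: "'a pair_pre_digraph \<Rightarrow> 'a set \<Rightarrow> bool" where
  "wcd G D \<longleftrightarrow> weakly_convex G D \<and> dominating G D"

lemma wcd_subset: "wcd G D \<Longrightarrow> D \<subseteq> pverts G"
  by (simp add: wcd_def dominating_def)

text \<open>The vertex \<open>c\<close> bounds the distance by two, so a shortest walk inside
  \<open>D\<close> has exactly one inner vertex. If \<open>c\<close> is the only common neighbour,
  it is thereby forced into \<open>D\<close>.\<close>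

lemma wcd_common_neighbour:
  assumes "pair_wf_digraph G" "wcd G D" "a \<in> D" "b \<in> D" "a \<noteq> b" "(a, b) \<notin> parcs G"
    and "(a, c) \<in> parcs G" "(c, b) \<in> parcs G"
  shows "\<exists>c\<in>D. (a, c) \<in> parcs G \<and> (c, b) \<in> parcs G"
proof -
  obtain n where n: "(a, b) \<in> (parcs G \<inter> D \<times> D) ^^ n"
    "\<And>k. (a, b) \<in> parcs G ^^ k \<Longrightarrow> n \<le> k"
    using assms weakly_convex_iff_relpow[OF assms(1)] unfolding wcd_def by metis
  have "(a, b) \<in> parcs G ^^ 2" using assms(7,8) by (auto simp: numeral_2_eq_2)
  from n(2)[OF this] have "n = 0 \<or> n = 1 \<or> n = 2" by auto
  then show ?thesis using n(1) assms(5,6) by (auto simp: numeral_2_eq_2)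
qed

text \<open>A leaf outside \<open>D\<close> must be dominated by \<open>s\<close>; a leaf inside
  \<open>D\<close> reaches \<open>b\<close> within \<open>D\<close>, and its first step goes to
  \<open>s\<close>.\<close>

lemma wcd_leaf_support:
  assumes "pair_wf_digraph G" "wcd G D" "l \<in> pverts G" "\<And>y. (l, y) \<in> parcs G \<Longrightarrow> y = s"
    and "b \<in> D" "b \<noteq> l"
  shows "s \<in> D"
proof (cases "l \<in> D")
  case True
  then obtain n where n: "(l, b) \<in> (parcs G \<inter> D \<times> D) ^^ n"
    using assms weakly_convex_iff_relpow[OF assms(1)] unfolding wcd_def by metis
  with assms(6) obtain k where "(l, b) \<in> (parcs G \<inter> D \<times> D) ^^ Suc k" by (cases n) auto
  then obtain c where "(l, c) \<in> parcs G \<inter> D \<times> D" by (blast dest: relpow_Suc_D2)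
  with assms(4) show ?thesis by blast
next
  case False
  with assms(2-4) show ?thesis unfolding wcd_def dominating_def by blast
qed

text \<open>Two distinct supports supply the second member \<open>b\<close> of \<open>D\<close> for
  every leaf: another support \<open>t\<close> or its leaf lies in \<open>D\<close> by
  domination.\<close>

lemma wcd_leaf_supports:
  assumes "pair_wf_digraph G" "wcd G D"
    and "\<And>s. s \<in> S \<Longrightarrow> lf s \<in> pverts G" "\<And>s y. s \<in> S \<Longrightarrow> (lf s, y) \<in> parcs G \<Longrightarrow> y = s"
    and "\<And>s. s \<in> S \<Longrightarrow> lf s \<notin> S" "inj_on lf S" "p \<in> S" "q \<in> S" "p \<noteq> q"
  shows "S \<subseteq> D"
proof
  fix s assume s: "s \<in> S"
  obtain t where t: "t \<in> S" "t \<noteq> s" using assms(7-9) by metis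
  then have "lf t \<noteq> lf s" using s assms(6) by (auto dest: inj_onD)
  have "\<exists>b\<in>D. b \<noteq> lf s"
  proof (cases "lf t \<in> D")
    case False
    then have "t \<in> D" using assms(2,3,4) t unfolding wcd_def dominating_def by blast
    then show ?thesis using assms(5) s t by metis
  qed (use \<open>lf t \<noteq> lf s\<close> in blast)
  then show "s \<in> D" using wcd_leaf_support[OF assms(1,2) assms(3,4)] s by blast
qed

lemma wcon_domination_number_alt: "\<gamma>\<^sub>w\<^sub>c\<^sub>o\<^sub>n G = (LEAST n. \<exists>D. wcd G D \<and> card D = n)"
  by (simp add: wcon_domination_number_def wcd_def)

lemma wcon_domination_number_eqI:
  assumes "wcd G D" "\<And>D'. wcd G D' \<Longrightarrow> card D \<le> card D'"
  shows "\<gamma>\<^sub>w\<^sub>c\<^sub>o\<^sub>n G = card D"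
  unfolding wcon_domination_number_alt using assms by (intro Least_equality) auto

lemma wcon_domination_number_forced:
  assumes "finite (pverts G)" "wcd G D" "\<And>D'. wcd G D' \<Longrightarrow> D \<subseteq> D'"
  shows "\<gamma>\<^sub>w\<^sub>c\<^sub>o\<^sub>n G = card D"
  using assms by (intro wcon_domination_number_eqI) (auto intro!: card_mono dest: wcd_subset finite_subset)

text \<open>The constant map to \<open>v\<close> is a retraction, and a dominating set of a nonempty
  graph is nonempty.\<close>

lemma wcon_domination_number_universal:
  assumes "pair_wf_digraph G" "finite (pverts G)" "v \<in> pverts G"
    and "\<And>x. x \<in> pverts G \<Longrightarrow> x \<noteq> v \<Longrightarrow> (x, v) \<in> parcs G"
  shows "wcd G {v}" "\<gamma>\<^sub>w\<^sub>c\<^sub>o\<^sub>n G = 1"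
proof -
  have "weakly_convex G {v}"
    using assms by (intro weakly_convex_retract[where r = "\<lambda>_. v"]) auto
  then show *: "wcd G {v}" using assms by (auto simp: wcd_def dominating_def)
  have "card {v} \<le> card D" if "wcd G D" for D
  proof -
    have "finite D" "D \<noteq> {}"
      using that assms(2,3) by (auto simp: wcd_def dominating_def intro: finite_subset)
    then show ?thesis by (simp add: Suc_le_eq card_gt_0_iff)
  qed
  from wcon_domination_number_eqI[OF * this] show "\<gamma>\<^sub>w\<^sub>c\<^sub>o\<^sub>n G = 1" by simp
qed

text \<open>Members of \<open>D\<close> are joined by paths and every other vertex is adjacent to a
  member. Applied after the deletion, this shows that the edge is not a cut edge.\<close>

lemma wcd_imp_connected:
  assumes "pair_graph G" "wcd G D" "pverts G \<noteq> {}"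
  shows "Digraph_Component.connected G"
proof -
  interpret pair_graph G by fact
  have D: "x \<rightarrow>\<^sup>*\<^bsub>G\<^esub> y" if "x \<in> D" "y \<in> D" for x y
    using assms(2) that unfolding wcd_def weakly_convex_def shortest_path_def
    by (meson awalkI_apath reachable_awalk)
  have ex: "\<exists>y\<in>D. x \<rightarrow>\<^sup>*\<^bsub>G\<^esub> y \<and> y \<rightarrow>\<^sup>*\<^bsub>G\<^esub> x" if "x \<in> pverts G" for x
  proof (cases "x \<in> D")
    case False
    then obtain y where "y \<in> D" "(x, y) \<in> parcs G"
      using assms(2) \<open>x \<in> pverts G\<close> by (auto simp: wcd_def dominating_def)
    then show ?thesis using arcs_symmetric by (meson reachable_adjI with_proj_simps(3))
  qed (use that in auto)
  have "x \<rightarrow>\<^sup>*\<^bsub>G\<^esub> y" if xy: "x \<in> pverts G" "y \<in> pverts G" for x y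
    using ex[OF xy(1)] ex[OF xy(2)] D reachable_trans by meson
  with assms(3) show ?thesis
    unfolding Digraph_Component.connected_def
    by (intro strongly_connectedI) (auto intro: reachable_mk_symmetricI)
qed


section \<open>Transport to natural numbers\<close>

definition map_graph :: "('a \<Rightarrow> 'b) \<Rightarrow> 'a pair_pre_digraph \<Rightarrow> 'b pair_pre_digraph" where
  "map_graph f G = \<lparr> pverts = f ` pverts G, parcs = map_prod f f ` parcs G \<rparr>"

lemma map_graph_sel [simp]:
  "pverts (map_graph f G) = f ` pverts G" "parcs (map_graph f G) = map_prod f f ` parcs G"
  by (simp_all add: map_graph_def)

lemma pair_graph_map_graph:
  assumes "inj f" "pair_graph G"
  shows "pair_graph (map_graph f G)"
proof -
  interpret pair_graph G by fact
  show ?thesis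
    by unfold_locales
      (auto simp: symmetric_def sym_def inj_eq[OF assms(1)] pair_finite_verts pair_finite_arcs
        intro: in_arcsD1 in_arcsD2 dest: no_loops' arcs_symmetric)
qed

lemma map_prod_image_iff:
  assumes "inj f"
  shows "(f a, f b) \<in> map_prod f f ` R \<longleftrightarrow> (a, b) \<in> R"
  using inj_image_mem_iff[OF prod.inj_map[OF assms assms], of "(a, b)" R] by simp

lemma delete_edge_map_graph:
  assumes "inj f"
  shows "delete_edge (map_graph f G) (map_prod f f e) = map_graph f (delete_edge G e)"
proof -
  have "inj (map_prod f f)" using assms by (simp add: prod.inj_map)
  then show ?thesis by (cases e) (simp add: delete_edge_def map_graph_def image_set_diff)
qed

lemma relpow_map_prod_iff:
  assumes "inj f"
  shows "(f a, f b) \<in> (map_prod f f ` R) ^^ n \<longleftrightarrow> (a, b) \<in> R ^^ n"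
proof (induction n arbitrary: b)
  case 0
  then show ?case by (simp add: inj_eq[OF assms])
next
  case (Suc n)
  \<comment> \<open>The last arc lies in the image relation, so the vertex before \<open>f b\<close>
    has the form \<open>f c\<close>.\<close>
  have "(f a, f b) \<in> (map_prod f f ` R) ^^ Suc n \<longleftrightarrow>
    (\<exists>c. (f a, f c) \<in> (map_prod f f ` R) ^^ n \<and> (c, b) \<in> R)"
    by (auto simp: inj_eq[OF assms] image_iff map_prod_def split: prod.splits)
  with Suc show ?case by auto
qed

lemma wcd_map_graph_image:
  assumes "inj f" "pair_graph G"
  shows "wcd (map_graph f G) (f ` D) \<longleftrightarrow> wcd G D"
proof -
  interpret pair_graph G by fact
  interpret M: pair_graph "map_graph f G" by (rule pair_graph_map_graph[OF assms])
  have "map_prod f f ` parcs G \<inter> f ` D \<times> f ` D = map_prod f f ` (parcs G \<inter> D \<times> D)"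
    by (auto simp: inj_eq[OF assms(1)] inj_image_mem_iff[OF assms(1)])
  then have "weakly_convex (map_graph f G) (f ` D) \<longleftrightarrow> weakly_convex G D"
    by (simp add: weakly_convex_iff_relpow pair_wf_digraph M.pair_wf_digraph
      relpow_map_prod_iff[OF assms(1)] inj_image_subset_iff[OF assms(1)])
  moreover have "dominating (map_graph f G) (f ` D) \<longleftrightarrow> dominating G D"
    by (simp add: dominating_def map_prod_image_iff[OF assms(1)] inj_image_subset_iff[OF assms(1)]
      flip: image_set_diff[OF assms(1)])
  ultimately show ?thesis by (simp add: wcd_def)
qed

text \<open>Every candidate set in the image graph consists of image vertices and is itself an
  image, so the same cardinalities occur.\<close>

lemma wcon_domination_number_map_graph:
  assumes "inj f" "pair_graph G"
  shows "\<gamma>\<^sub>w\<^sub>c\<^sub>o\<^sub>n (map_graph f G) = \<gamma>\<^sub>w\<^sub>c\<^sub>o\<^sub>n G"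
proof -
  have card: "card (f ` D) = card D" for D
    using assms(1) by (simp add: card_image inj_on_def)
  have "(\<exists>D. wcd (map_graph f G) D \<and> card D = n) \<longleftrightarrow> (\<exists>D. wcd G D \<and> card D = n)" for n
  proof
    assume "\<exists>D. wcd (map_graph f G) D \<and> card D = n"
    then obtain D where D: "wcd (map_graph f G) D" "card D = n" by blast
    from wcd_subset[OF D(1)] obtain D' where "D = f ` D'" by (auto simp: subset_image_iff)
    with D have "wcd G D' \<and> card D' = n" using wcd_map_graph_image[OF assms, of D'] card by simp
    then show "\<exists>D. wcd G D \<and> card D = n" ..
  next
    assume "\<exists>D. wcd G D \<and> card D = n"
    then obtain D where "wcd G D" "card D = n" by blast
    then have "wcd (map_graph f G) (f ` D) \<and> card (f ` D) = n"
      using wcd_map_graph_image[OF assms, of D] card by simp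
    then show "\<exists>D. wcd (map_graph f G) D \<and> card D = n" ..
  qed
  then show ?thesis by (simp add: wcon_domination_number_alt)
qed

text \<open>The sets \<open>D\<close> and \<open>D'\<close> act as certificates of connectedness
  before and after the deletion.\<close>

lemma realize_on_nat:
  fixes G :: "'a::countable pair_pre_digraph"
  assumes "pair_graph G" "e \<in> parcs G" "wcd G D" "wcd (delete_edge G e) D'"
    and "int (\<gamma>\<^sub>w\<^sub>c\<^sub>o\<^sub>n (delete_edge G e)) - int (\<gamma>\<^sub>w\<^sub>c\<^sub>o\<^sub>n G) = k"
  shows "\<exists>(G :: nat pair_pre_digraph) e.
    pair_graph G \<and> Digraph_Component.connected G \<and> e \<in> parcs G \<and> \<not> cut_edge G e \<and>
    int (\<gamma>\<^sub>w\<^sub>c\<^sub>o\<^sub>n (delete_edge G e)) - int (\<gamma>\<^sub>w\<^sub>c\<^sub>o\<^sub>n G) = k"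
proof -
  interpret pair_graph G by fact
  let ?f = "to_nat :: 'a \<Rightarrow> nat"
  let ?H = "map_graph ?f G" and ?e = "map_prod ?f ?f e"
  have inj: "inj ?f" by simp
  have del: "delete_edge ?H ?e = map_graph ?f (delete_edge G e)"
    by (rule delete_edge_map_graph[OF inj])
  have pg: "pair_graph (delete_edge G e)" by (rule pair_graph_delete_edge[OF assms(1)])
  have ne: "pverts G \<noteq> {}" using assms(2) arc_fst_in_verts by blast
  have "Digraph_Component.connected ?H"
    using wcd_imp_connected[OF pair_graph_map_graph[OF inj assms(1)]]
      wcd_map_graph_image[OF inj assms(1)] assms(3) ne by auto
  moreover have "Digraph_Component.connected (delete_edge ?H ?e)"
    unfolding del
    using wcd_imp_connected[OF pair_graph_map_graph[OF inj pg]]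
      wcd_map_graph_image[OF inj pg] assms(4) ne by (auto simp: delete_edge_def)
  moreover have "?e \<in> parcs ?H" using assms(2) by simp
  moreover have "int (\<gamma>\<^sub>w\<^sub>c\<^sub>o\<^sub>n (delete_edge ?H ?e)) - int (\<gamma>\<^sub>w\<^sub>c\<^sub>o\<^sub>n ?H) = k"
    unfolding del wcon_domination_number_map_graph[OF inj pg]
      wcon_domination_number_map_graph[OF inj assms(1)] by (rule assms(5))
  moreover note pair_graph_map_graph[OF inj assms(1)]
  ultimately show ?thesis unfolding cut_edge_def by blast
qed

section \<open>The graphs\<close>

text \<open>Symmetrizing and clipping here allow one orientation per edge and one edge set for all
  sizes \<open>m\<close>.\<close>

definition ugraph :: "'a set \<Rightarrow> ('a \<times> 'a) set \<Rightarrow> 'a pair_pre_digraph" where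
  "ugraph S E = \<lparr> pverts = S, parcs = {(x, y) \<in> S \<times> S. x \<noteq> y \<and> ((x, y) \<in> E \<or> (y, x) \<in> E)} \<rparr>"

lemma pverts_ugraph [simp]: "pverts (ugraph S E) = S"
  by (simp add: ugraph_def)

lemma parcs_ugraph_iff [simp]:
  "(x, y) \<in> parcs (ugraph S E) \<longleftrightarrow> x \<in> S \<and> y \<in> S \<and> x \<noteq> y \<and> ((x, y) \<in> E \<or> (y, x) \<in> E)"
  by (simp add: ugraph_def)

lemma pair_graph_ugraph:
  assumes "finite S"
  shows "pair_graph (ugraph S E)"
proof -
  have "parcs (ugraph S E) \<subseteq> S \<times> S" by (auto simp: ugraph_def)
  then have "finite (parcs (ugraph S E))" using assms by (auto dest: finite_subset)
  then show ?thesis using assms by unfold_locales (auto simp: symmetric_def sym_def)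
qed

lemma pair_wf_digraph_ugraph: "pair_wf_digraph (ugraph S E)"
  by unfold_locales auto

lemma delete_edge_ugraph:
  assumes "(u, v) \<notin> E" "(v, u) \<notin> E"
  shows "delete_edge (ugraph S (insert (u, v) E)) (u, v) = ugraph S E"
  using assms by (auto simp: delete_edge_def ugraph_def)

text \<open>By symmetry the retraction is checked on one orientation of each edge, and mutual
  reachability follows from reaching a hub \<open>c\<close>.\<close>

lemma weakly_convex_ugraph:
  assumes "D \<subseteq> S"
    and "\<And>x y. (x, y) \<in> E \<Longrightarrow> x \<in> S \<Longrightarrow> y \<in> S \<Longrightarrow>
      r x = r y \<or> (r x, r y) \<in> parcs (ugraph S E)"
    and "\<And>x. x \<in> S \<Longrightarrow> r x \<in> D" "\<And>x. x \<in> D \<Longrightarrow> r x = x"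
    and conn: "\<And>x. x \<in> D \<Longrightarrow> (x, c) \<in> (parcs (ugraph S E))\<^sup>*"
  shows "weakly_convex (ugraph S E) D"
proof (rule weakly_convex_retract[where r = r, OF pair_wf_digraph_ugraph])
  have sym: "sym (parcs (ugraph S E))" by (auto simp: sym_def)
  show "(a, b) \<in> (parcs (ugraph S E))\<^sup>*" if "a \<in> D" "b \<in> D" for a b
    using conn[OF that(1)] conn[OF that(2)] sym_rtrancl[OF sym] by (meson rtrancl_trans symD)
  show "r x = r y \<or> (r x, r y) \<in> parcs (ugraph S E)" if "(x, y) \<in> parcs (ugraph S E)" for x y
    using assms(2)[of x y] assms(2)[of y x] that by auto
qed (use assms in auto)

lemma dominating_ugraph:
  assumes "D \<subseteq> S" "\<And>x. x \<in> S \<Longrightarrow> x \<notin> D \<Longrightarrow> w x \<in> D \<and> (x, w x) \<in> parcs (ugraph S E)"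
  shows "dominating (ugraph S E) D"
  using assms unfolding dominating_def pverts_ugraph by blast

text \<open>
  The vertices outside \<open>Leaf\<close> form the core; \<open>Leaf s\<close> is a pendant vertex attached to \<open>s\<close>.
  In the names below, \<open>up\<close> refers to \<open>k > 0\<close> and \<open>down\<close> to \<open>k < 0\<close>, and the edge sets leave out
  the deleted edge \<open>UV\<close>. Edges with an end outside the vertex set are discarded by \<^const>\<open>ugraph\<close>.
\<close>

datatype node = A nat | X nat | U | V | B | W | Z | Leaf node

instance node :: countable by countable_datatype

text \<open>Serves both as the retraction folding leaves onto their supports and as the choice of a
  dominating neighbour.\<close>

fun strip :: "node \<Rightarrow> node" where
  "strip (Leaf s) = s"
| "strip s = s"

section \<open>Graphs for positive \<open>k\<close>\<close>

definition supports_up :: "nat \<Rightarrow> node set" where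
  "supports_up m = A ` {..<m} \<union> {U, V}"

text \<open>For \<open>m > 0\<close> this is the minimum set after the deletion, while
  \<open>supports_up\<close> is the minimum set before it.\<close>

definition core_up :: "nat \<Rightarrow> node set" where
  "core_up m = supports_up m \<union> X ` {..<m}"

definition verts_up :: "nat \<Rightarrow> node set" where
  "verts_up m = core_up m \<union> Leaf ` supports_up m"

inductive_set edges_up :: "(node \<times> node) set" where
  [simp]: "(A i, U) \<in> edges_up"
| [simp]: "(A i, X i) \<in> edges_up"
| [simp]: "(X i, V) \<in> edges_up"
| [simp]: "(s, Leaf s) \<in> edges_up"

lemma mem_supports_up [simp]:
  "A i \<in> supports_up m \<longleftrightarrow> i < m" "X i \<notin> supports_up m"
  "U \<in> supports_up m" "V \<in> supports_up m" "B \<notin> supports_up m"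
  "W \<notin> supports_up m" "Z \<notin> supports_up m" "Leaf s \<notin> supports_up m"
  by (auto simp: supports_up_def)

lemma mem_core_up [simp]:
  "A i \<in> core_up m \<longleftrightarrow> i < m"
  "X i \<in> core_up m \<longleftrightarrow> i < m" "U \<in> core_up m" "V \<in> core_up m"
  "B \<notin> core_up m" "W \<notin> core_up m" "Z \<notin> core_up m"
  "Leaf s \<notin> core_up m"
  by (auto simp: core_up_def)

lemma mem_verts_up [simp]:
  "A i \<in> verts_up m \<longleftrightarrow> i < m"
  "X i \<in> verts_up m \<longleftrightarrow> i < m" "U \<in> verts_up m" "V \<in> verts_up m"
  "B \<notin> verts_up m" "W \<notin> verts_up m" "Z \<notin> verts_up m"
  "Leaf s \<in> verts_up m \<longleftrightarrow> s \<in> supports_up m"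
  by (auto simp: verts_up_def)

lemma supports_up_subset [simp]:
  "x \<in> supports_up m \<Longrightarrow> x \<in> core_up m" "x \<in> supports_up m \<Longrightarrow> x \<in> verts_up m"
  "x \<in> core_up m \<Longrightarrow> x \<in> verts_up m"
  by (auto simp: core_up_def verts_up_def)

lemma strip_up [simp]:
  "x \<in> core_up m \<Longrightarrow> strip x = x" "x \<in> supports_up m \<Longrightarrow> strip x = x"
  by (cases x; simp)+

lemma strip_in_core_up: "x \<in> verts_up m \<Longrightarrow> strip x \<in> core_up m"
  by (cases x) auto

lemma finite_verts_up [simp]: "finite (verts_up m)"
  by (simp add: verts_up_def core_up_def supports_up_def)

lemma card_up: "card (supports_up m) = m + 2" "card (core_up m) = 2 * m + 2"
proof -
  have *: "card (A ` {..<m}) = m" "card (X ` {..<m}) = m"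
    by (simp_all add: card_image inj_on_def)
  show S: "card (supports_up m) = m + 2"
    unfolding supports_up_def by (subst card_Un_disjoint) (auto simp: *)
  show "card (core_up m) = 2 * m + 2"
    unfolding core_up_def by (subst card_Un_disjoint) (auto simp: * S, auto simp: supports_up_def)
qed

text \<open>Leaving \<open>E\<close> open covers the graphs with and without \<open>UV\<close> at
  once.\<close>

lemma supports_up_forced:
  assumes "wcd (ugraph (verts_up m) E) D" "E \<subseteq> insert (U, V) edges_up"
  shows "supports_up m \<subseteq> D"
proof (rule wcd_leaf_supports[OF pair_wf_digraph_ugraph assms(1)])
  show "y = s" if "s \<in> supports_up m" "(Leaf s, y) \<in> parcs (ugraph (verts_up m) E)" for s y
  proof -
    \<comment> \<open>The edge scheme also joins \<open>Leaf s\<close> to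
      \<open>Leaf (Leaf s)\<close>, but that node is absent because \<open>Leaf s\<close> is not a
      support.\<close>
    have "(Leaf s, y) \<in> insert (U, V) edges_up \<or> (y, Leaf s) \<in> insert (U, V) edges_up"
      and "y \<noteq> Leaf (Leaf s)"
      using that assms(2) by auto
    then show ?thesis by (auto elim!: edges_up.cases)
  qed
  show "U \<in> supports_up m" "V \<in> supports_up m" "U \<noteq> V" by auto
qed (auto simp: inj_on_def)

lemma core_up_forced:
  assumes "wcd (ugraph (verts_up m) edges_up) D"
  shows "core_up m \<subseteq> D"
proof -
  let ?G = "ugraph (verts_up m) edges_up"
  have S: "supports_up m \<subseteq> D" by (rule supports_up_forced[OF assms]) blast
  moreover have "X i \<in> D" if "i < m" for i
  proof -
    \<comment> \<open>The neighbours of \<open>A i\<close> are \<open>U\<close>, \<open>X i\<close>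
      and its leaf; with \<open>UV\<close> gone only \<open>X i\<close> is adjacent to
      \<open>V\<close>.\<close>
    have "\<exists>c\<in>D. (A i, c) \<in> parcs ?G \<and> (c, V) \<in> parcs ?G"
      using S that
      by (intro wcd_common_neighbour[OF pair_wf_digraph_ugraph assms, where c = "X i"])
        (auto elim!: edges_up.cases)
    then show ?thesis by (auto elim!: edges_up.cases)
  qed
  ultimately show ?thesis by (auto simp: core_up_def)
qed

lemma wcd_up: "wcd (ugraph (verts_up m) (insert (U, V) edges_up)) (supports_up m)"
proof -
  let ?G = "ugraph (verts_up m) (insert (U, V) edges_up)"
  have "weakly_convex ?G (supports_up m)"
  \<comment> \<open>Sending \<open>X i\<close> to \<open>U\<close> maps the edge from
    \<open>X i\<close> to \<open>V\<close> onto \<open>UV\<close>: this is where the extra edge is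
    used.\<close>
  proof (rule weakly_convex_ugraph[where c = U and r = "\<lambda>x. case strip x of X i \<Rightarrow> U | y \<Rightarrow> y"])
    show "(x, U) \<in> (parcs ?G)\<^sup>*" if "x \<in> supports_up m" for x
      using that by (cases x) (auto intro!: r_into_rtrancl)
    show "(case strip x of X i \<Rightarrow> U | y \<Rightarrow> y) \<in> supports_up m" if "x \<in> verts_up m" for x
      using strip_in_core_up[OF that] by (cases "strip x") auto
    show "(case strip x of X i \<Rightarrow> U | y \<Rightarrow> y) = x" if "x \<in> supports_up m" for x
      using that by (cases x) auto
  qed (auto elim!: edges_up.cases)
  moreover have "dominating ?G (supports_up m)"
  \<comment> \<open>The retraction cannot supply the dominating neighbour, as \<open>X i\<close> is
    not adjacent to \<open>U\<close>.\<close>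
  proof (rule dominating_ugraph[where w = "\<lambda>x. case strip x of X i \<Rightarrow> V | y \<Rightarrow> y"])
    show "(case strip x of X i \<Rightarrow> V | y \<Rightarrow> y) \<in> supports_up m \<and>
        (x, case strip x of X i \<Rightarrow> V | y \<Rightarrow> y) \<in> parcs ?G"
      if "x \<in> verts_up m" "x \<notin> supports_up m" for x
      using that by (cases x; cases "strip x") (auto elim!: edges_up.cases)
  qed auto
  ultimately show ?thesis by (simp add: wcd_def)
qed

lemma wcd_up_deleted:
  assumes "0 < m"
  shows "wcd (ugraph (verts_up m) edges_up) (core_up m)"
proof -
  let ?G = "ugraph (verts_up m) edges_up"
  have "weakly_convex ?G (core_up m)"
  proof (rule weakly_convex_ugraph[where c = V and r = strip])
    have X: "(X i, V) \<in> (parcs ?G)\<^sup>*" if "i < m" for i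
      using that by (intro r_into_rtrancl) (auto elim!: edges_up.cases)
    have A: "(A i, V) \<in> (parcs ?G)\<^sup>*" if "i < m" for i
      using that by (intro converse_rtrancl_into_rtrancl[OF _ X]) (auto elim!: edges_up.cases)
    \<comment> \<open>Without \<open>UV\<close>, the vertex \<open>U\<close> reaches
      \<open>V\<close> only through some \<open>A i\<close> and \<open>X i\<close>, hence the need
      for \<open>0 < m\<close>.\<close>
    have "(U, V) \<in> (parcs ?G)\<^sup>*"
      using assms by (intro converse_rtrancl_into_rtrancl[OF _ A[of 0]]) (auto elim!: edges_up.cases)
    with X A show "(x, V) \<in> (parcs ?G)\<^sup>*" if "x \<in> core_up m" for x
      using that by (auto simp: core_up_def supports_up_def)
  qed (auto elim!: edges_up.cases simp: strip_in_core_up)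
  moreover have "dominating ?G (core_up m)"
  proof (rule dominating_ugraph[where w = strip])
    show "strip x \<in> core_up m \<and> (x, strip x) \<in> parcs ?G"
      if "x \<in> verts_up m" "x \<notin> core_up m" for x
      using that by (cases x; cases "strip x") (auto elim!: edges_up.cases)
  qed auto
  ultimately show ?thesis by (simp add: wcd_def)
qed

section \<open>Graphs for negative \<open>k\<close>\<close>

definition supports_down :: "nat \<Rightarrow> node set" where
  "supports_down m = A ` {..<m} \<union> {B, Z, W, V}"

definition core_down :: "nat \<Rightarrow> node set" where
  "core_down m = supports_down m \<union> insert U (X ` {..<m})"

definition verts_down :: "nat \<Rightarrow> node set" where
  "verts_down m = core_down m \<union> Leaf ` supports_down m"

inductive_set edges_down :: "(node \<times> node) set" where
  [simp]: "(A i, B) \<in> edges_down"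
| [simp]: "(A i, X i) \<in> edges_down"
| [simp]: "(X i, U) \<in> edges_down"
| [simp]: "(U, Z) \<in> edges_down"
| [simp]: "(Z, B) \<in> edges_down"
| [simp]: "(B, W) \<in> edges_down"
| [simp]: "(W, V) \<in> edges_down"
| [simp]: "(s, Leaf s) \<in> edges_down"

lemma mem_supports_down [simp]:
  "A i \<in> supports_down m \<longleftrightarrow> i < m" "X i \<notin> supports_down m"
  "U \<notin> supports_down m" "V \<in> supports_down m" "B \<in> supports_down m"
  "W \<in> supports_down m" "Z \<in> supports_down m" "Leaf s \<notin> supports_down m"
  by (auto simp: supports_down_def)

lemma mem_core_down [simp]:
  "A i \<in> core_down m \<longleftrightarrow> i < m"
  "X i \<in> core_down m \<longleftrightarrow> i < m" "U \<in> core_down m"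
  "V \<in> core_down m" "B \<in> core_down m" "W \<in> core_down m" "Z \<in> core_down m"
  "Leaf s \<notin> core_down m"
  by (auto simp: core_down_def)

lemma mem_verts_down [simp]:
  "A i \<in> verts_down m \<longleftrightarrow> i < m"
  "X i \<in> verts_down m \<longleftrightarrow> i < m" "U \<in> verts_down m"
  "V \<in> verts_down m" "B \<in> verts_down m" "W \<in> verts_down m" "Z \<in> verts_down m"
  "Leaf s \<in> verts_down m \<longleftrightarrow> s \<in> supports_down m"
  by (auto simp: verts_down_def)

lemma supports_down_subset [simp]:
  "x \<in> supports_down m \<Longrightarrow> x \<in> core_down m" "x \<in> supports_down m \<Longrightarrow> x \<in> verts_down m"
  "x \<in> core_down m \<Longrightarrow> x \<in> verts_down m"
  by (auto simp: core_down_def verts_down_def)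

lemma strip_down [simp]:
  "x \<in> core_down m \<Longrightarrow> strip x = x" "x \<in> supports_down m \<Longrightarrow> strip x = x"
  by (cases x; simp)+

lemma strip_in_core_down: "x \<in> verts_down m \<Longrightarrow> strip x \<in> core_down m"
  by (cases x) auto

lemma finite_verts_down [simp]: "finite (verts_down m)"
  by (simp add: verts_down_def core_down_def supports_down_def)

lemma card_down: "card (supports_down m) = m + 4" "card (core_down m) = 2 * m + 5"
proof -
  have *: "card (A ` {..<m}) = m" "card (X ` {..<m}) = m"
    by (simp_all add: card_image inj_on_def)
  show S: "card (supports_down m) = m + 4"
    unfolding supports_down_def by (subst card_Un_disjoint) (auto simp: *)
  have "card (insert U (X ` {..<m})) = m + 1" by (subst card_insert_disjoint) (auto simp: *)
  then show "card (core_down m) = 2 * m + 5"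
    unfolding core_down_def by (subst card_Un_disjoint) (auto simp: S, auto simp: supports_down_def)
qed

lemma supports_down_forced:
  assumes "wcd (ugraph (verts_down m) E) D" "E \<subseteq> insert (U, V) edges_down"
  shows "supports_down m \<subseteq> D"
proof (rule wcd_leaf_supports[OF pair_wf_digraph_ugraph assms(1)])
  show "y = s" if "s \<in> supports_down m" "(Leaf s, y) \<in> parcs (ugraph (verts_down m) E)" for s y
  proof -
    have "(Leaf s, y) \<in> insert (U, V) edges_down \<or> (y, Leaf s) \<in> insert (U, V) edges_down"
      and "y \<noteq> Leaf (Leaf s)"
      using that assms(2) by auto
    then show ?thesis by (auto elim!: edges_down.cases)
  qed
  show "B \<in> supports_down m" "V \<in> supports_down m" "B \<noteq> V" by auto
qed (auto simp: inj_on_def)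

lemma core_down_forced:
  assumes "wcd (ugraph (verts_down m) (insert (U, V) edges_down)) D"
  shows "core_down m \<subseteq> D"
proof -
  let ?G = "ugraph (verts_down m) (insert (U, V) edges_down)"
  have S: "supports_down m \<subseteq> D" by (rule supports_down_forced[OF assms]) blast
  \<comment> \<open>Besides their leaves, \<open>Z\<close> is adjacent to \<open>U\<close> and
    \<open>B\<close>, and \<open>V\<close> to \<open>U\<close> and \<open>W\<close>. Once
    \<open>U\<close> is in \<open>D\<close>, it can be paired with each \<open>A i\<close>.\<close>
  have "\<exists>c\<in>D. (Z, c) \<in> parcs ?G \<and> (c, V) \<in> parcs ?G"
    using S by (intro wcd_common_neighbour[OF pair_wf_digraph_ugraph assms, where c = U])
      (auto elim!: edges_down.cases)
  then have U: "U \<in> D" by (auto elim!: edges_down.cases)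
  have "X i \<in> D" if "i < m" for i
  proof -
    have "\<exists>c\<in>D. (A i, c) \<in> parcs ?G \<and> (c, U) \<in> parcs ?G"
      using S U that
      by (intro wcd_common_neighbour[OF pair_wf_digraph_ugraph assms, where c = "X i"])
        (auto elim!: edges_down.cases)
    then show ?thesis by (auto elim!: edges_down.cases)
  qed
  with S U show ?thesis by (auto simp: core_down_def)
qed

text \<open>The routes to the hub \<open>B\<close> avoid \<open>UV\<close>, so they exist before and
  after the deletion, also for \<open>m = 0\<close>.\<close>

lemma core_down_connected:
  assumes "x \<in> core_down m" "edges_down \<subseteq> E"
  shows "(x, B) \<in> (parcs (ugraph (verts_down m) E))\<^sup>*"
proof -
  let ?R = "parcs (ugraph (verts_down m) E)"
  have *: "(x, y) \<in> ?R" if "(x, y) \<in> edges_down \<or> (y, x) \<in> edges_down" "x \<noteq> y"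
    "x \<in> verts_down m" "y \<in> verts_down m" for x y
    using that assms(2) by auto
  have A: "(A i, B) \<in> ?R\<^sup>*" if "i < m" for i
    using that by (intro r_into_rtrancl *) auto
  have X: "(X i, B) \<in> ?R\<^sup>*" if "i < m" for i
    using that by (intro converse_rtrancl_into_rtrancl[OF * A]) auto
  have Z: "(Z, B) \<in> ?R\<^sup>*" by (intro r_into_rtrancl *) auto
  have U: "(U, B) \<in> ?R\<^sup>*" by (intro converse_rtrancl_into_rtrancl[OF * Z]) auto
  have W: "(W, B) \<in> ?R\<^sup>*" by (intro r_into_rtrancl *) auto
  have V: "(V, B) \<in> ?R\<^sup>*" by (intro converse_rtrancl_into_rtrancl[OF * W]) auto
  show ?thesis using assms(1) A X Z U W V by (auto simp: core_down_def supports_down_def)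
qed

lemma wcd_down: "wcd (ugraph (verts_down m) (insert (U, V) edges_down)) (core_down m)"
proof -
  let ?G = "ugraph (verts_down m) (insert (U, V) edges_down)"
  have "weakly_convex ?G (core_down m)"
  proof (rule weakly_convex_ugraph[where c = B and r = strip])
    show "(x, B) \<in> (parcs ?G)\<^sup>*" if "x \<in> core_down m" for x
      using that by (rule core_down_connected) blast
  qed (auto elim!: edges_down.cases simp: strip_in_core_down)
  moreover have "dominating ?G (core_down m)"
  proof (rule dominating_ugraph[where w = strip])
    show "strip x \<in> core_down m \<and> (x, strip x) \<in> parcs ?G"
      if "x \<in> verts_down m" "x \<notin> core_down m" for x
      using that by (cases x; cases "strip x") (auto elim!: edges_down.cases)
  qed auto
  ultimately show ?thesis by (simp add: wcd_def)
qed

lemma wcd_down_deleted: "wcd (ugraph (verts_down m) edges_down) (supports_down m)"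
proof -
  let ?G = "ugraph (verts_down m) edges_down"
  have "weakly_convex ?G (supports_down m)"
  \<comment> \<open>Folding \<open>U\<close> and all \<open>X i\<close> onto \<open>B\<close>
    preserves the remaining edges; \<open>UV\<close> would be sent to the non-edge
    \<open>BV\<close>.\<close>
  proof (rule weakly_convex_ugraph[where c = B
        and r = "\<lambda>x. case strip x of X i \<Rightarrow> B | U \<Rightarrow> B | y \<Rightarrow> y"])
    show "(x, B) \<in> (parcs ?G)\<^sup>*" if "x \<in> supports_down m" for x
      using that by (intro core_down_connected) (auto simp: core_down_def)
    show "(case strip x of X i \<Rightarrow> B | U \<Rightarrow> B | y \<Rightarrow> y) \<in> supports_down m" if "x \<in> verts_down m" for x
      using strip_in_core_down[OF that] by (cases "strip x") auto
    show "(case strip x of X i \<Rightarrow> B | U \<Rightarrow> B | y \<Rightarrow> y) = x" if "x \<in> supports_down m" for x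
      using that by (cases x) auto
  qed (auto elim!: edges_down.cases)
  moreover have "dominating ?G (supports_down m)"
  proof (rule dominating_ugraph[where w = "\<lambda>x. case strip x of X i \<Rightarrow> A i | U \<Rightarrow> Z | y \<Rightarrow> y"])
    show "(case strip x of X i \<Rightarrow> A i | U \<Rightarrow> Z | y \<Rightarrow> y) \<in> supports_down m \<and>
        (x, case strip x of X i \<Rightarrow> A i | U \<Rightarrow> Z | y \<Rightarrow> y) \<in> parcs ?G"
      if "x \<in> verts_down m" "x \<notin> supports_down m" for x
      using that by (cases x; cases "strip x") (auto elim!: edges_down.cases)
  qed auto
  ultimately show ?thesis by (simp add: wcd_def)
qed

theorem theorem4p1:
  fixes k :: int
  shows "\<exists>(G :: nat pair_pre_digraph) e.
           pair_graph G \<and> Digraph_Component.connected G \<and>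
           e \<in> parcs G \<and> \<not> cut_edge G e \<and>
           int (wcon_domination_number (delete_edge G e)) - int (wcon_domination_number G) = k"
proof -
  consider "0 < k" | "k = 0" | "k < 0" by linarith
  then show ?thesis
  proof cases
    case 1
    \<comment> \<open>The numbers \<open>m + 2\<close> before and \<open>2 * m + 2\<close> after the
      deletion differ by \<open>m\<close>.\<close>
    define m where "m = nat k"
    let ?G = "ugraph (verts_up m) (insert (U, V) edges_up)"
    have m: "0 < m" "int m = k" using 1 by (auto simp: m_def)
    have del: "delete_edge ?G (U, V) = ugraph (verts_up m) edges_up"
      by (rule delete_edge_ugraph) (auto elim!: edges_up.cases)
    have "\<gamma>\<^sub>w\<^sub>c\<^sub>o\<^sub>n ?G = m + 2"
      using wcon_domination_number_forced[OF _ wcd_up supports_up_forced] by (simp add: card_up)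
    moreover have "\<gamma>\<^sub>w\<^sub>c\<^sub>o\<^sub>n (ugraph (verts_up m) edges_up) = 2 * m + 2"
      using wcon_domination_number_forced[OF _ wcd_up_deleted[OF m(1)] core_up_forced]
      by (simp add: card_up)
    moreover have "(U, V) \<in> parcs ?G" by simp
    ultimately show ?thesis
      using m wcd_up wcd_up_deleted
      by (intro realize_on_nat[of ?G "(U, V)"] pair_graph_ugraph) (auto simp: del)
  next
    case 2
    \<comment> \<open>In the triangle, vertex 2 stays adjacent to both others when the edge between
      0 and 1 is deleted.\<close>
    let ?E = "{(0, 2), (1, 2)} :: (nat \<times> nat) set"
    let ?G = "\<lambda>E. ugraph {0, 1, 2 :: nat} E"
    have del: "delete_edge (?G (insert (0, 1) ?E)) (0, 1) = ?G ?E"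
      by (rule delete_edge_ugraph) auto
    have "wcd (?G (insert (0, 1) ?E)) {2}" "\<gamma>\<^sub>w\<^sub>c\<^sub>o\<^sub>n (?G (insert (0, 1) ?E)) = 1"
      by (rule wcon_domination_number_universal[where v = 2, OF pair_wf_digraph_ugraph]; auto)+
    moreover have "wcd (?G ?E) {2}" "\<gamma>\<^sub>w\<^sub>c\<^sub>o\<^sub>n (?G ?E) = 1"
      by (rule wcon_domination_number_universal[where v = 2, OF pair_wf_digraph_ugraph]; auto)+
    ultimately show ?thesis
      using 2 by (intro realize_on_nat[of "?G (insert (0, 1) ?E)" "(0, 1)"] pair_graph_ugraph)
        (auto simp: del simp del: One_nat_def)
  next
    case 3
    \<comment> \<open>Here the difference is \<open>(m + 4) - (2 * m + 5) = -(m + 1)\<close>; the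
      value \<open>m = 0\<close> yields \<open>k = -1\<close>.\<close>
    define m where "m = nat (- k - 1)"
    let ?G = "ugraph (verts_down m) (insert (U, V) edges_down)"
    have m: "int m = - k - 1" using 3 by (auto simp: m_def)
    have del: "delete_edge ?G (U, V) = ugraph (verts_down m) edges_down"
      by (rule delete_edge_ugraph) (auto elim!: edges_down.cases)
    have "\<gamma>\<^sub>w\<^sub>c\<^sub>o\<^sub>n ?G = 2 * m + 5"
      using wcon_domination_number_forced[OF _ wcd_down core_down_forced] by (simp add: card_down)
    moreover have "\<gamma>\<^sub>w\<^sub>c\<^sub>o\<^sub>n (ugraph (verts_down m) edges_down) = m + 4"
      using wcon_domination_number_forced[OF _ wcd_down_deleted supports_down_forced]
      by (simp add: card_down subset_insertI)
    moreover have "(U, V) \<in> parcs ?G" by simp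
    ultimately show ?thesis
      using m wcd_down wcd_down_deleted
      by (intro realize_on_nat[of ?G "(U, V)"] pair_graph_ugraph) (auto simp: del)
  qed
qed

end
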